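(* Let $q$ be a prime power, $k$ a positive integer, and let $f\in\mathcal{L}_{k,q}$ be a scattered polynomial. Then $f$ is a Sidon space polynomial.
   Context: $\mathcal{L}_{k,q}$ is the set of linearized polynomials ($q$-polynomials) $\sum_{i=0}^{t}f_ix^{q^i}$ with $f_i\in\mathbb{F}_{q^k}$; each is identified with the $\mathbb{F}_q$-linear map $\mathbb{F}_{q^k}\to\mathbb{F}_{q^k}$ it defines. $f\in\mathcal{L}_{k,q}$ is scattered if for all $a,b\in\mathbb{F}_{q^k}^*$, $f(a)/a=f(b)/b$ implies that $a$ and $b$ are $\mathbb{F}_q$-proportional. For $x_0\in\mathbb{F}_{q^k}$ put $S_{x_0,f}=\{\lambda\in\mathbb{F}_{q^k} : f(\lambda x_0)=\lambda f(x_0)\}$. The polynomial $f$ is a Sidon space polynomial if $S_{x_0,f}\cap S_{x_1,f}=\mathbb{F}_q$ for all $x_0,x_1\in\mathbb{F}_{q^k}$ that are not $\mathbb{F}_q$-proportional (i.e. that are $\mathbb{F}_q$-linearly independent). *)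

theory Defs
  imports
    "HOL-Library.Cardinality"
    "HOL-Computational_Algebra.Polynomial"
    "HOL-Number_Theory.Prime_Powers"
begin

definition is_subfield :: "'a::field set \<Rightarrow> bool" where
  "is_subfield F \<longleftrightarrow>
     0 \<in> F \<and> 1 \<in> F \<and>
     (\<forall>a\<in>F. \<forall>b\<in>F. a + b \<in> F \<and> a * b \<in> F) \<and>
     (\<forall>a\<in>F. - a \<in> F \<and> inverse a \<in> F)"

text \<open>The linearized polynomials over the ambient field \<open>'a\<close>, which plays the role of the
  field with \<open>q ^ k\<close> elements. The map defined by such a polynomial \<open>f\<close> is \<open>poly f\<close>.\<close>

definition linearized_polys :: "nat \<Rightarrow> 'a::field poly set" where
  "linearized_polys q = {f. \<exists>t c. f = (\<Sum>i\<le>t. monom (c i) (q ^ i))}"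

text \<open>The disjunction makes \<open>0\<close> proportional to every element, so that proportionality is
  linear dependence of the pair; see \<open>proportional_iff_dependent\<close>.\<close>

definition proportional :: "'a::field set \<Rightarrow> 'a \<Rightarrow> 'a \<Rightarrow> bool" where
  "proportional F a b \<longleftrightarrow> (\<exists>c\<in>F. a = c * b \<or> b = c * a)"

lemma proportional_iff_dependent:
  assumes "is_subfield F"
  shows "proportional F a b \<longleftrightarrow>
    (\<exists>c\<in>F. \<exists>d\<in>F. (c \<noteq> 0 \<or> d \<noteq> 0) \<and> c * a + d * b = 0)"
proof
  assume "proportional F a b"
  then obtain c where c: "c \<in> F" "a = c * b \<or> b = c * a"
    by (auto simp: proportional_def)
  have F: "1 \<in> F" "- c \<in> F"
    using assms c(1) by (auto simp: is_subfield_def)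
  from c(2) show "\<exists>c\<in>F. \<exists>d\<in>F. (c \<noteq> 0 \<or> d \<noteq> 0) \<and> c * a + d * b = 0"
  proof
    assume "a = c * b"
    then show ?thesis
      using F by (intro bexI[of _ 1] bexI[of _ "- c"]) auto
  next
    assume "b = c * a"
    then show ?thesis
      using F by (intro bexI[of _ "- c"] bexI[of _ 1]) auto
  qed
next
  assume "\<exists>c\<in>F. \<exists>d\<in>F. (c \<noteq> 0 \<or> d \<noteq> 0) \<and> c * a + d * b = 0"
  then obtain c d where cd: "c \<in> F" "d \<in> F" "c \<noteq> 0 \<or> d \<noteq> 0" "c * a + d * b = 0"
    by blast
  have F: "- (inverse c * d) \<in> F" "- (inverse d * c) \<in> F"
    using assms cd(1,2) by (auto simp: is_subfield_def)
  from cd(3) show "proportional F a b"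
  proof
    assume "c \<noteq> 0"
    moreover from cd(4) have "c * a = - (d * b)"
      by (simp add: eq_neg_iff_add_eq_0)
    ultimately have "a = - (inverse c * d) * b"
      by (simp add: field_simps)
    then show ?thesis
      using F(1) unfolding proportional_def by blast
  next
    assume "d \<noteq> 0"
    moreover from cd(4) have "d * b = - (c * a)"
      by (simp add: eq_neg_iff_add_eq_0 add.commute)
    ultimately have "b = - (inverse d * c) * a"
      by (simp add: field_simps)
    then show ?thesis
      using F(2) unfolding proportional_def by blast
  qed
qed

definition scattered :: "'a::field set \<Rightarrow> 'a poly \<Rightarrow> bool" where
  "scattered F f \<longleftrightarrow>
     (\<forall>a b. a \<noteq> 0 \<longrightarrow> b \<noteq> 0 \<longrightarrow> poly f a / a = poly f b / b \<longrightarrow> proportional F a b)"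

definition S_set :: "'a::field \<Rightarrow> 'a poly \<Rightarrow> 'a set" where
  "S_set x\<^sub>0 f = {l. poly f (l * x\<^sub>0) = l * poly f x\<^sub>0}"

definition sidon_space_poly :: "'a::field set \<Rightarrow> 'a poly \<Rightarrow> bool" where
  "sidon_space_poly F f \<longleftrightarrow>
     (\<forall>x\<^sub>0 x\<^sub>1. \<not> proportional F x\<^sub>0 x\<^sub>1 \<longrightarrow> S_set x\<^sub>0 f \<inter> S_set x\<^sub>1 f = F)"

end

theory Submission
  imports Defs
begin

text \<open>For nonzero x the set \<open>S_set x f\<close> is exactly F, so intersecting two such
  sets gives F. If l is a nonzero element of it, then f takes the same ratio f(y)/y at y = l*x and y
  = x; scatteredness makes l*x and x proportional, hence l lies in F
  (\<open>scattered_S_set_subset\<close>). Conversely F lies in every \<open>S_set x f\<close>,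
  because f is F-linear: elements of F satisfy c^q = c (\<open>subfield_power_card\<close>), so they
  pass through each monomial of f (\<open>linearized_poly_mult\<close>).\<close>

lemma subfield_power_card:
  fixes F :: "'a::field set"
  assumes F: "is_subfield F" "finite F" and c: "c \<in> F"
  shows "c ^ card F = c"
proof (cases "c = 0")
  case True
  have "card F \<noteq> 0"
    using F by (auto simp: is_subfield_def)
  then show ?thesis
    using True by simp
next
  case False
  let ?G = "F - {0}"
  \<comment> \<open>As in Fermat's little theorem: multiplication by c permutes the nonzero elements
    of F, so comparing their product before and after, and cancelling it, gives c^(|F|-1) =
    1.\<close>
  have "bij_betw ((*) c) ?G ?G"
  proof (rule bij_betw_byWitness[where f' = "(*) (inverse c)"])
    show "(*) c ` ?G \<subseteq> ?G" "(*) (inverse c) ` ?G \<subseteq> ?G"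
      using F(1) c False by (auto simp: is_subfield_def)
  qed (use False in \<open>auto simp: field_simps\<close>)
  then have "\<Prod>?G = (\<Prod>x\<in>?G. c * x)"
    by (rule prod.reindex_bij_betw[symmetric])
  also have "\<dots> = c ^ card ?G * \<Prod>?G"
    by (simp add: prod.distrib)
  finally have "c ^ card ?G = 1"
    using F(2) by simp
  moreover have "card F = Suc (card ?G)"
    using F by (intro card.remove) (auto simp: is_subfield_def)
  ultimately show ?thesis
    by simp
qed

text \<open>Every exponent in f is a power of q, and c is fixed by all iterates of the q-th power
  map, so c factors out of each term.\<close>

lemma linearized_poly_mult:
  assumes f: "f \<in> linearized_polys q" and c: "c ^ q = c"
  shows "poly f (c * x) = c * poly f x"
proof -
  obtain t a where f_eq: "f = (\<Sum>i\<le>t. monom (a i) (q ^ i))"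
    using f by (auto simp: linearized_polys_def)
  have "c ^ (q ^ i) = c" for i
    by (induction i) (simp_all add: power_mult c)
  then show ?thesis
    by (simp add: f_eq poly_sum poly_monom power_mult_distrib sum_distrib_left mult.left_commute)
qed

lemma scattered_S_set_subset:
  assumes F: "is_subfield F" and f: "scattered F f" and x: "x \<noteq> 0"
  shows "S_set x f \<subseteq> F"
proof
  fix l assume "l \<in> S_set x f"
  then have l: "poly f (l * x) = l * poly f x"
    by (simp add: S_set_def)
  show "l \<in> F"
  proof (cases "l = 0")
    case True
    then show ?thesis
      using F by (simp add: is_subfield_def)
  next
    case False
    then have "poly f (l * x) / (l * x) = poly f x / x"
      using l by simp
    then have "proportional F (l * x) x"
      using f x False by (simp add: scattered_def)
    then obtain c where c: "c \<in> F" "l * x = c * x \<or> x = c * (l * x)"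
      by (auto simp: proportional_def)
    \<comment> \<open>Cancelling x leaves l = c or 1 = c*l, one case for each direction of
      proportionality.\<close>
    then have "l = c \<or> l = inverse c"
      using x False by (auto simp: eq_divide_eq inverse_eq_divide mult.commute)
    then show ?thesis
      using F c(1) by (auto simp: is_subfield_def)
  qed
qed

theorem theorem4p1:
  fixes F :: "'a::{field,finite} set" and q k :: nat and f :: "'a poly"
  assumes "primepow q" and "k > 0"
    and "CARD('a) = q ^ k"
    and "is_subfield F" and "card F = q"
    and "f \<in> linearized_polys q"
    and "scattered F f"
  shows "sidon_space_poly F f"
  unfolding sidon_space_poly_def
proof (intro allI impI)
  fix x\<^sub>0 x\<^sub>1 assume indep: "\<not> proportional F x\<^sub>0 x\<^sub>1"
  have "0 \<in> F"
    using assms(4) by (simp add: is_subfield_def)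
  \<comment> \<open>Zero is proportional to everything, with factor 0.\<close>
  then have "x\<^sub>0 \<noteq> 0"
    using indep by (auto simp: proportional_def)
  then have "S_set x\<^sub>0 f \<subseteq> F"
    using assms by (intro scattered_S_set_subset)
  moreover have "F \<subseteq> S_set x f" for x
    using assms subfield_power_card[of F] linearized_poly_mult[of f q]
    by (auto simp: S_set_def)
  ultimately show "S_set x\<^sub>0 f \<inter> S_set x\<^sub>1 f = F"
    by blast
qed

end
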